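(* Let $g,h:\mathbb{N}\to\mathbb{C}$ be arbitrary functions, let $f:\mathbb{N}^2\to\mathbb{C}$ be given by $$f(k,n)=\sum_{d\mid \gcd(k,n)} g(d)h(n/d)\qquad (k,n\in\mathbb{N}),$$ let $r\in\mathbb{N}$, and for $m_1,\ldots,m_r\in\mathbb{N}$ with $m=\operatorname{lcm}[m_1,\ldots,m_r]$ let $$F_f(m_1,\ldots,m_r)= \frac1{m} \sum_{k=1}^m f(k,m_1)\cdots f(k,m_r).$$ Then: (i) For all $m_1,\ldots,m_r\in\mathbb{N}$, with $m=\operatorname{lcm}[m_1,\ldots,m_r]$, $F_f$ has the representations $$F_f(m_1,\ldots,m_r)= \sum_{d_1\mid m_1, \ldots, d_r\mid m_r} \frac{g(d_1)\cdots g(d_r)}{\operatorname{lcm}[d_1,\ldots, d_r]}\, h(m_1/d_1)\cdots h(m_r/d_r),$$ $$F_f(m_1,\ldots,m_r)= \frac1{m} \sum_{d\mid m} f(d,m_1) \cdots f(d,m_r)\, \phi(m/d).$$ (ii) If $g$ and $h$ are multiplicative functions, then $F_f$ is multiplicative as a function of $r$ variables.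
   Context: $\mathbb{N}=\{1,2,\ldots\}$. $\phi$ is Euler's totient function. A function $F:\mathbb{N}^r\to\mathbb{C}$ is called multiplicative (as a function of several variables; for $r=1$ this is the usual notion) if it is not identically zero and $F(m_1n_1,\ldots,m_rn_r)=F(m_1,\ldots,m_r)F(n_1,\ldots,n_r)$ for all $m_1,\ldots,m_r,n_1,\ldots,n_r\in\mathbb{N}$ with $\gcd(m_1\cdots m_r,\,n_1\cdots n_r)=1$. *)

theory Defs
  imports Complex_Main "HOL-Library.FuncSet" "HOL-Number_Theory.Totient"
begin

text \<open>The positive integers are the positive elements of \<^typ>\<open>nat\<close>; values of functions at \<open>0\<close>
  are irrelevant. An \<open>r\<close>-tuple of positive integers is a function on \<open>{1..r}\<close>, extended by
  \<^const>\<open>undefined\<close> so that equality of functions is equality of tuples.\<close>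

definition pos_tuples :: "nat \<Rightarrow> (nat \<Rightarrow> nat) set" where
  "pos_tuples r = {1..r} \<rightarrow>\<^sub>E {0<..}"

definition multiplicative_multi :: "nat \<Rightarrow> ((nat \<Rightarrow> nat) \<Rightarrow> complex) \<Rightarrow> bool" where
  "multiplicative_multi r F \<longleftrightarrow>
     (\<exists>n\<in>pos_tuples r. F n \<noteq> 0) \<and>
     (\<forall>m\<in>pos_tuples r. \<forall>n\<in>pos_tuples r.
        gcd (\<Prod>i\<in>{1..r}. m i) (\<Prod>i\<in>{1..r}. n i) = 1 \<longrightarrow>
        F (\<lambda>i\<in>{1..r}. m i * n i) = F m * F n)"

definition multiplicative :: "(nat \<Rightarrow> complex) \<Rightarrow> bool" where
  "multiplicative g \<longleftrightarrow>
     (\<exists>n>0. g n \<noteq> 0) \<and>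
     (\<forall>m>0. \<forall>n>0. gcd m n = 1 \<longrightarrow> g (m * n) = g m * g n)"

lemma multiplicative_iff_multi:
  "multiplicative g \<longleftrightarrow> multiplicative_multi 1 (\<lambda>n. g (n 1))"
proof -
  have ex: "(\<exists>n\<in>pos_tuples 1. P (n 1)) \<longleftrightarrow> (\<exists>k>0. P k)" for P
  proof
    assume "\<exists>k>0. P k"
    then obtain k where "k > 0" "P k" by blast
    then show "\<exists>n\<in>pos_tuples 1. P (n 1)"
      by (intro bexI[of _ "\<lambda>i\<in>{1..1}. k"]) (auto simp: pos_tuples_def)
  qed (auto simp: pos_tuples_def PiE_iff)
  have all: "(\<forall>n\<in>pos_tuples 1. P (n 1)) \<longleftrightarrow> (\<forall>k>0. P k)" for P
    using ex[of "\<lambda>k. \<not> P k"] by blast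
  show ?thesis
    unfolding multiplicative_def multiplicative_multi_def
    using ex[of "\<lambda>k. g k \<noteq> 0"]
      all[of "\<lambda>a. \<forall>b>0. gcd a b = 1 \<longrightarrow> g (a * b) = g a * g b"]
      all[of "\<lambda>b. gcd a b = 1 \<longrightarrow> g (a * b) = g a * g b" for a]
    by simp
qed

definition lcm_mean :: "nat \<Rightarrow> (nat \<Rightarrow> nat \<Rightarrow> complex) \<Rightarrow> (nat \<Rightarrow> nat) \<Rightarrow> complex" where
  "lcm_mean r f m =
     (let M = (LCM i\<in>{1..r}. m i) in
       1 / of_nat M * (\<Sum>k = 1..M. \<Prod>i\<in>{1..r}. f k (m i)))"

end

theory Submission
  imports Defs
begin

text \<open>
  Expanding the product of the sums \<open>f(k,m\<^sub>i)\<close> and exchanging summations, the tuple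
  \<open>(d\<^sub>1,\<dots>,d\<^sub>r)\<close> is counted once for each \<open>k \<le> m\<close> divisible by
  \<open>lcm[d\<^sub>1,\<dots>,d\<^sub>r]\<close>; this gives the first representation. Since \<open>f(k,m\<^sub>i)\<close> depends on
  \<open>k\<close> only through \<open>gcd(k,m)\<close>, grouping the \<open>k\<close> by this value gives the second one.
  Multiplicativity is read off the second representation: the divisors of \<open>m n\<close> with \<open>m\<close>
  and \<open>n\<close> coprime are the products of divisors of \<open>m\<close> and \<open>n\<close>, uniquely, and
  \<open>f(de, m\<^sub>i n\<^sub>i) = f(d,m\<^sub>i) f(e,n\<^sub>i)\<close> for such divisors \<open>d\<close> and \<open>e\<close>.
\<close>

section \<open>Gcds, divisors and lcms of coprime factors\<close>

lemma gcd_mult_coprime_right: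
  fixes a b d :: nat
  assumes "coprime a b"
  shows "gcd d (a * b) = gcd d a * gcd d b"
proof (rule dvd_antisym)
  \<comment> \<open>A divisor of \<open>a * b\<close> splits into a divisor of \<open>a\<close> and
    a divisor of \<open>b\<close>; both also divide \<open>d\<close>, because their product
    does.\<close>
  obtain x y where xy: "gcd d (a * b) = x * y" "x dvd a" "y dvd b"
    using division_decomp[of "gcd d (a * b)" a b] by auto
  then have "x dvd d" "y dvd d"
    by (metis dvd_mult_left dvd_mult_right gcd_dvd1)+
  with xy show "gcd d (a * b) dvd gcd d a * gcd d b"
    by (simp add: mult_dvd_mono)
next
  have "coprime (gcd d a) (gcd d b)"
    using assms by (meson coprime_divisors gcd_dvd2)
  then have "gcd d a * gcd d b dvd d"
    by (intro divides_mult) auto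
  then show "gcd d a * gcd d b dvd gcd d (a * b)"
    by (simp add: mult_dvd_mono)
qed

text \<open>After the gcd is split over \<open>a\<close> and \<open>b\<close>, the factor
  \<open>e\<close> is coprime to \<open>a\<close> and \<open>d\<close> is coprime to
  \<open>b\<close>, so each cancels. This separates the summation range of
  \<open>f (d * e) (a * b)\<close>.\<close>

lemma gcd_mult_mult_coprime:
  fixes a b d e :: nat
  assumes "coprime (a * d) (b * e)"
  shows "gcd (d * e) (a * b) = gcd d a * gcd e b"
proof -
  have cop: "coprime a b" "coprime a e" "coprime b d"
    using assms by (auto simp: coprime_commute)
  have "gcd (d * e) (a * b) = gcd (d * e) a * gcd (d * e) b"
    by (rule gcd_mult_coprime_right[OF cop(1)])
  also have "gcd (d * e) a = gcd d a"
    using cop(2) by (simp add: gcd_mult_left_right_cancel)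
  also have "gcd (d * e) b = gcd e b"
    using cop(3) by (simp add: gcd_mult_left_left_cancel)
  finally show ?thesis .
qed

text \<open>Multiplication of pairs is a bijection onto the divisors of \<open>a * b\<close>, with
  inverse sending \<open>d\<close> to \<open>(gcd d a, gcd d b)\<close>.\<close>

lemma sum_divisors_mult_coprime:
  fixes a b :: nat and F :: "nat \<Rightarrow> 'a::comm_monoid_add"
  assumes "coprime a b"
  shows "(\<Sum>d | d dvd a * b. F d) = (\<Sum>x | x dvd a. \<Sum>y | y dvd b. F (x * y))"
proof -
  have eq: "gcd (x * y) a = x \<and> gcd (x * y) b = y" if "x dvd a" "y dvd b" for x y
  proof -
    have "coprime a y" "coprime b x"
      using assms that coprime_divisors[of y b a a] coprime_divisors[of x a b b]
      by (simp_all add: coprime_commute)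
    then show ?thesis
      using that by (simp add: gcd_mult_left_right_cancel gcd_mult_left_left_cancel gcd_nat.absorb1)
  qed
  have "(\<Sum>d | d dvd a * b. F d) = (\<Sum>(x, y)\<in>{x. x dvd a} \<times> {y. y dvd b}. F (x * y))"
  proof (rule sum.reindex_bij_witness[where i = "\<lambda>(x, y). x * y" and j = "\<lambda>d. (gcd d a, gcd d b)"])
    fix d assume "d \<in> {d. d dvd a * b}"
    then show "(case (gcd d a, gcd d b) of (x, y) \<Rightarrow> x * y) = d"
      using gcd_mult_coprime_right[OF assms, of d] by (simp add: gcd_nat.absorb1)
    then show "(case (gcd d a, gcd d b) of (x, y) \<Rightarrow> F (x * y)) = F d"
      by simp
  qed (auto simp: eq mult_dvd_mono)
  then show ?thesis
    by (simp add: sum.cartesian_product)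
qed

text \<open>Each of the two lcms divides the lcm of the products, since \<open>m i\<close> and
  \<open>n i\<close> divide \<open>m i * n i\<close>; being coprime, they divide it jointly. The
  other divisibility is termwise.\<close>

lemma Lcm_image_mult_coprime:
  fixes m n :: "'i \<Rightarrow> nat"
  assumes "coprime (LCM i\<in>I. m i) (LCM i\<in>I. n i)"
  shows "(LCM i\<in>I. m i * n i) = (LCM i\<in>I. m i) * (LCM i\<in>I. n i)"
proof (rule dvd_antisym)
  show "(LCM i\<in>I. m i * n i) dvd (LCM i\<in>I. m i) * (LCM i\<in>I. n i)"
    by (rule Lcm_least) (auto intro!: mult_dvd_mono)
  have *: "m i * n i dvd (LCM i\<in>I. m i * n i)" if "i \<in> I" for i
    using that by auto
  have "(LCM i\<in>I. m i) dvd (LCM i\<in>I. m i * n i)" "(LCM i\<in>I. n i) dvd (LCM i\<in>I. m i * n i)"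
    using dvd_mult_left[OF *] dvd_mult_right[OF *] by (auto intro!: Lcm_least)
  then show "(LCM i\<in>I. m i) * (LCM i\<in>I. n i) dvd (LCM i\<in>I. m i * n i)"
    using assms by (rule divides_mult)
qed

text \<open>Gives positivity of an lcm, and lets coprimality of two products descend to the
  lcms.\<close>

lemma Lcm_image_dvd_prod:
  fixes m :: "'i \<Rightarrow> nat"
  assumes "finite I"
  shows "(LCM i\<in>I. m i) dvd (\<Prod>i\<in>I. m i)"
  by (rule Lcm_least) (use assms in \<open>auto intro: dvd_prodI\<close>)

lemma Lcm_image_pos:
  fixes m :: "'i \<Rightarrow> nat"
  assumes "finite I" and "\<And>i. i \<in> I \<Longrightarrow> m i > 0"
  shows "(LCM i\<in>I. m i) > 0"
proof -
  have "(\<Prod>i\<in>I. m i) > 0"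
    using assms by (simp add: prod_pos)
  then show ?thesis
    using Lcm_image_dvd_prod[OF assms(1), of m] dvd_pos_nat by blast
qed

section \<open>Counting multiples and gcd classes in \<open>{1..M}\<close>\<close>

lemma card_multiples:
  fixes L M :: nat
  assumes "L dvd M" "M > 0"
  shows "card {k\<in>{1..M}. L dvd k} = M div L"
proof -
  \<comment> \<open>Zero divides only zero, and \<open>M\<close> is positive.\<close>
  have L: "L > 0"
    using assms by (rule_tac Nat.gr0I) auto
  have "bij_betw (\<lambda>j. L * j) {1..M div L} {k\<in>{1..M}. L dvd k}"
    by (rule bij_betw_byWitness[where f' = "\<lambda>k. k div L"])
       (use assms L in \<open>auto simp: Suc_le_eq div_le_mono elim!: dvdE\<close>)
  then show ?thesis
    using bij_betw_same_card by fastforce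
qed

text \<open>The numbers with gcd \<open>d\<close> are \<open>d * j\<close> with
  \<open>j \<le> M div d\<close> coprime to \<open>M div d\<close>, so each gcd class has totient
  size.\<close>

lemma sum_gcd_group:
  fixes F :: "nat \<Rightarrow> 'a::comm_semiring_1"
  assumes "M > 0"
  shows "(\<Sum>k = 1..M. F (gcd k M)) = (\<Sum>d | d dvd M. F d * of_nat (totient (M div d)))"
proof -
  have "(\<Sum>k = 1..M. F (gcd k M)) =
        (\<Sum>d | d dvd M. \<Sum>k | k \<in> {1..M} \<and> gcd k M = d. F (gcd k M))"
    by (rule sum.group[symmetric]) (use assms in auto)
  also have "\<dots> = (\<Sum>d | d dvd M. F d * of_nat (totient (M div d)))"
  proof (rule sum.cong)
    fix d assume "d \<in> {d. d dvd M}"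
    then have "card {k \<in> {0<..M}. gcd k M = d} = totient (M div d)"
      using assms by (intro card_gcd_eq_totient) auto
    moreover have "{k \<in> {0<..M}. gcd k M = d} = {k. k \<in> {1..M} \<and> gcd k M = d}"
      by auto
    ultimately show "(\<Sum>k | k \<in> {1..M} \<and> gcd k M = d. F (gcd k M)) = F d * of_nat (totient (M div d))"
      by (simp add: mult.commute)
  qed simp
  finally show ?thesis .
qed

section \<open>Basic facts on multiplicative functions of one variable\<close>

lemma multiplicative_mult:
  "multiplicative g \<Longrightarrow> m > 0 \<Longrightarrow> n > 0 \<Longrightarrow> coprime m n \<Longrightarrow> g (m * n) = g m * g n"
  by (simp add: multiplicative_def)

lemma multiplicative_1:
  assumes "multiplicative g"
  shows "g 1 = 1"
proof -
  obtain n where n: "n > 0" "g n \<noteq> 0"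
    using assms by (auto simp: multiplicative_def)
  then have "g (n * 1) = g n * g 1"
    by (intro multiplicative_mult[OF assms]) auto
  with n show ?thesis
    by simp
qed

section \<open>The two representations of the mean\<close>

lemma lcm_mean_eq_sum_tuples:
  fixes f :: "nat \<Rightarrow> nat \<Rightarrow> complex"
  assumes f: "\<And>k n. k > 0 \<Longrightarrow> n > 0 \<Longrightarrow> f k n = (\<Sum>d | d dvd gcd k n. g d * h (n div d))"
    and m: "\<And>i. i \<in> {1..r} \<Longrightarrow> m i > 0"
  shows "lcm_mean r f m =
    (\<Sum>d\<in>(\<Pi>\<^sub>E i\<in>{1..r}. {e. e dvd m i}).
       (\<Prod>i\<in>{1..r}. g (d i)) / of_nat (LCM i\<in>{1..r}. d i) * (\<Prod>i\<in>{1..r}. h (m i div d i)))"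
proof -
  define M where "M = (LCM i\<in>{1..r}. m i)"
  define D where "D = (\<Pi>\<^sub>E i\<in>{1..r}. {e. e dvd m i})"
  define T where "T d = (\<Prod>i\<in>{1..r}. g (d i)) * (\<Prod>i\<in>{1..r}. h (m i div d i))" for d
  have M: "M > 0"
    unfolding M_def using m by (intro Lcm_image_pos) auto
  \<comment> \<open>Replacing the range of divisors of \<open>gcd k (m i)\<close> by all divisors of
    \<open>m i\<close> with an indicator makes the index set independent of \<open>k\<close>, as the
    later exchange of sums requires.\<close>
  have f': "f k (m i) = (\<Sum>e | e dvd m i. if e dvd k then g e * h (m i div e) else 0)"
    if "k > 0" "i \<in> {1..r}" for k i
  proof -
    have "{e. e dvd gcd k (m i)} = {e \<in> {e. e dvd m i}. e dvd k}"
      by auto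
    then show ?thesis
      using f[OF that(1) m[OF that(2)]] m[OF that(2)] sum.inter_filter[of "{e. e dvd m i}"] by simp
  qed
  have prod_f: "(\<Prod>i\<in>{1..r}. f k (m i)) = (\<Sum>d\<in>D. if (LCM i\<in>{1..r}. d i) dvd k then T d else 0)"
    if "k > 0" for k
  proof -
    have "(\<Prod>i\<in>{1..r}. f k (m i)) =
        (\<Prod>i\<in>{1..r}. \<Sum>e | e dvd m i. if e dvd k then g e * h (m i div e) else 0)"
      using f'[OF that] by (intro prod.cong) auto
    also have "\<dots> = (\<Sum>d\<in>D. \<Prod>i\<in>{1..r}. if d i dvd k then g (d i) * h (m i div d i) else 0)"
      unfolding D_def by (rule prod_sum_PiE) (use m in auto)
    also have "\<dots> = (\<Sum>d\<in>D. if (LCM i\<in>{1..r}. d i) dvd k then T d else 0)"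
    proof (rule sum.cong)
      fix d
      show "(\<Prod>i\<in>{1..r}. if d i dvd k then g (d i) * h (m i div d i) else 0) =
          (if (LCM i\<in>{1..r}. d i) dvd k then T d else 0)"
      \<comment> \<open>The product of the indicators is the indicator of divisibility of
        \<open>k\<close> by the lcm: one failing \<open>d i\<close> makes the whole product
        vanish.\<close>
      proof (cases "\<forall>i\<in>{1..r}. d i dvd k")
        case True
        then show ?thesis
          by (simp add: Lcm_dvd_iff T_def prod.distrib)
      next
        case False
        then have "\<not> (LCM i\<in>{1..r}. d i) dvd k"
          by (auto simp: Lcm_dvd_iff)
        with False show ?thesis
          by (auto intro!: prod_zero)
      qed
    qed simp
    finally show ?thesis .
  qed
  have "(\<Sum>k = 1..M. \<Prod>i\<in>{1..r}. f k (m i)) =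
      (\<Sum>k = 1..M. \<Sum>d\<in>D. if (LCM i\<in>{1..r}. d i) dvd k then T d else 0)"
    by (rule sum.cong) (use prod_f in auto)
  also have "\<dots> = (\<Sum>d\<in>D. \<Sum>k = 1..M. if (LCM i\<in>{1..r}. d i) dvd k then T d else 0)"
    by (rule sum.swap)
  \<comment> \<open>Exactly \<open>M div L\<close> numbers in \<open>{1..M}\<close> are multiples of
    the tuple's lcm \<open>L\<close>. Since \<open>L\<close> divides \<open>M\<close>, the quotient
    is exact, and the factor \<open>of_nat M\<close> cancels the \<open>1 / of_nat M\<close> of the
    mean.\<close>
  also have "\<dots> = (\<Sum>d\<in>D. of_nat M * (T d / of_nat (LCM i\<in>{1..r}. d i)))"
  proof (rule sum.cong)
    fix d assume "d \<in> D"
    then have "d i dvd m i" if "i \<in> {1..r}" for i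
      using that by (auto simp: D_def PiE_iff)
    then have L: "(LCM i\<in>{1..r}. d i) dvd M"
      unfolding M_def by (intro Lcm_least) (auto intro!: dvd_trans[OF _ dvd_Lcm[OF imageI]])
    have "(\<Sum>k = 1..M. if (LCM i\<in>{1..r}. d i) dvd k then T d else 0) =
        (\<Sum>k | k \<in> {1..M} \<and> (LCM i\<in>{1..r}. d i) dvd k. T d)"
      by (rule sum.inter_filter[symmetric]) simp
    also have "\<dots> = of_nat (M div (LCM i\<in>{1..r}. d i)) * T d"
      using card_multiples[OF L M] by simp
    also have "\<dots> = of_nat M * (T d / of_nat (LCM i\<in>{1..r}. d i))"
      using L M by (auto elim!: dvdE)
    finally show "(\<Sum>k = 1..M. if (LCM i\<in>{1..r}. d i) dvd k then T d else 0) =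
      of_nat M * (T d / of_nat (LCM i\<in>{1..r}. d i))" .
  qed simp
  finally have "lcm_mean r f m = (\<Sum>d\<in>D. T d / of_nat (LCM i\<in>{1..r}. d i))"
    using M unfolding lcm_mean_def Let_def M_def[symmetric] sum_distrib_left[symmetric] by simp
  then show ?thesis
    by (simp add: D_def T_def)
qed

text \<open>The lcm enters through an equation for \<open>M\<close>, so that it can later be
  supplied in the factored form \<open>M * N\<close>.\<close>

lemma lcm_mean_eq_sum_totient:
  assumes f: "\<And>k n. k > 0 \<Longrightarrow> n > 0 \<Longrightarrow> f k n = (\<Sum>d | d dvd gcd k n. g d * h (n div d))"
    and m: "\<And>i. i \<in> {1..r} \<Longrightarrow> m i > 0"
    and M_def: "M = (LCM i\<in>{1..r}. m i)"
  shows "lcm_mean r f m =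
    1 / of_nat M * (\<Sum>d | d dvd M. (\<Prod>i\<in>{1..r}. f d (m i)) * of_nat (totient (M div d)))"
proof -
  have M: "M > 0"
    unfolding M_def using m by (intro Lcm_image_pos) auto
  \<comment> \<open>As \<open>m i\<close> divides \<open>M\<close>, replacing \<open>k\<close> by
    \<open>gcd k M\<close> keeps the common divisors with \<open>m i\<close>.\<close>
  have f_gcd: "f k (m i) = f (gcd k M) (m i)" if "k > 0" "i \<in> {1..r}" for k i
  proof -
    have "m i dvd M"
      using that by (auto simp: M_def)
    then have "d dvd gcd (gcd k M) (m i) \<longleftrightarrow> d dvd gcd k (m i)" for d
      by (auto intro: dvd_trans)
    then show ?thesis
      using f[OF that(1) m[OF that(2)]] f[of "gcd k M" "m i"] m[OF that(2)] M by simp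
  qed
  have "(\<Sum>k = 1..M. \<Prod>i\<in>{1..r}. f k (m i)) = (\<Sum>k = 1..M. \<Prod>i\<in>{1..r}. f (gcd k M) (m i))"
    by (intro sum.cong prod.cong refl f_gcd) auto
  also have "\<dots> = (\<Sum>d | d dvd M. (\<Prod>i\<in>{1..r}. f d (m i)) * of_nat (totient (M div d)))"
    using sum_gcd_group[OF M, of "\<lambda>d. \<Prod>i\<in>{1..r}. f d (m i)"] .
  finally show ?thesis
    by (simp add: lcm_mean_def Let_def M_def)
qed

section \<open>Multiplicativity of \<open>f\<close> on coprime data and of the mean\<close>

lemma gcd_convolution_mult:
  fixes f :: "nat \<Rightarrow> nat \<Rightarrow> complex"
  assumes f: "\<And>k n. k > 0 \<Longrightarrow> n > 0 \<Longrightarrow> f k n = (\<Sum>d | d dvd gcd k n. g d * h (n div d))"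
    and g: "multiplicative g" and h: "multiplicative h"
    and pos: "a > 0" "b > 0" "d > 0" "e > 0"
    and cop: "coprime (a * d) (b * e)"
  shows "f (d * e) (a * b) = f d a * f e b"
proof -
  have cop_ab: "coprime a b"
    using cop by simp
  have cop_gcd: "coprime (gcd d a) (gcd e b)"
    using cop_ab by (meson coprime_divisors gcd_dvd2)
  have "f (d * e) (a * b) = (\<Sum>x | x dvd gcd d a * gcd e b. g x * h (a * b div x))"
    using pos by (simp add: f gcd_mult_mult_coprime[OF cop])
  also have "\<dots> = (\<Sum>x | x dvd gcd d a. \<Sum>y | y dvd gcd e b. g (x * y) * h (a * b div (x * y)))"
    by (rule sum_divisors_mult_coprime[OF cop_gcd])
  also have "\<dots> = (\<Sum>x | x dvd gcd d a. \<Sum>y | y dvd gcd e b. (g x * h (a div x)) * (g y * h (b div y)))"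
  proof (intro sum.cong refl)
    fix x y assume xy: "x \<in> {x. x dvd gcd d a}" "y \<in> {y. y dvd gcd e b}"
    \<comment> \<open>The cofactors \<open>x'\<close> and \<open>y'\<close> are the arguments of
      \<open>h\<close>; like \<open>x\<close> and \<open>y\<close>, they inherit coprimality from
      \<open>a\<close> and \<open>b\<close>.\<close>
    then obtain x' y' where *: "a = x * x'" "b = y * y'"
      by (auto elim!: dvdE)
    with pos have xy_pos: "x > 0" "y > 0" "x' > 0" "y' > 0"
      by auto
    have "a * b div (x * y) = x' * y'"
      using xy_pos by (simp add: * ac_simps)
    moreover have "coprime x y" "coprime x' y'"
      using cop_ab by (simp_all add: *)
    ultimately show "g (x * y) * h (a * b div (x * y)) = (g x * h (a div x)) * (g y * h (b div y))"
      using xy_pos by (simp add: * multiplicative_mult[OF g] multiplicative_mult[OF h])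
  qed
  also have "\<dots> = f d a * f e b"
    using pos by (simp add: f sum_product)
  finally show ?thesis .
qed

lemma multiplicative_multi_lcm_mean:
  fixes f :: "nat \<Rightarrow> nat \<Rightarrow> complex"
  assumes f: "\<And>k n. k > 0 \<Longrightarrow> n > 0 \<Longrightarrow> f k n = (\<Sum>d | d dvd gcd k n. g d * h (n div d))"
    and g: "multiplicative g" and h: "multiplicative h"
  shows "multiplicative_multi r (lcm_mean r f)"
  unfolding multiplicative_multi_def
proof (intro conjI ballI impI)
  \<comment> \<open>The all-ones tuple witnesses nonvanishing: its lcm is 1, so the mean is a
    product of values \<open>f 1 1 = g 1 * h 1 = 1\<close>.\<close>
  define u where "u = (\<lambda>i\<in>{1..r}. 1::nat)"
  have "(LCM i\<in>{1..r}. u i) = 1"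
    by (rule dvd_antisym[OF Lcm_least]) (auto simp: u_def)
  moreover have "f 1 1 = 1"
    using multiplicative_1[OF g] multiplicative_1[OF h] by (simp add: f)
  ultimately have "lcm_mean r f u \<noteq> 0"
    by (simp add: lcm_mean_def u_def)
  moreover have "u \<in> pos_tuples r"
    by (auto simp: u_def pos_tuples_def)
  ultimately show "\<exists>n\<in>pos_tuples r. lcm_mean r f n \<noteq> 0"
    by blast
next
  fix m n assume "m \<in> pos_tuples r" "n \<in> pos_tuples r"
  then have m: "m i > 0" and n: "n i > 0" if "i \<in> {1..r}" for i
    using that by (auto simp: pos_tuples_def PiE_iff)
  assume "gcd (\<Prod>i\<in>{1..r}. m i) (\<Prod>i\<in>{1..r}. n i) = 1"
  define M where "M = (LCM i\<in>{1..r}. m i)"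
  define N where "N = (LCM i\<in>{1..r}. n i)"
  \<comment> \<open>\<open>A\<close> and \<open>B\<close> are the summands of the totient
    representation at \<open>m\<close> and at \<open>n\<close>; the summand at the product tuple
    will factor as \<open>A d * B e\<close>.\<close>
  define A where "A d = (\<Prod>i\<in>{1..r}. f d (m i)) * of_nat (totient (M div d))" for d
  define B where "B d = (\<Prod>i\<in>{1..r}. f d (n i)) * of_nat (totient (N div d))" for d
  have cop: "coprime M N"
    unfolding M_def N_def
    by (rule coprime_divisors[OF Lcm_image_dvd_prod Lcm_image_dvd_prod])
       (use \<open>gcd _ _ = 1\<close> in \<open>auto simp: coprime_iff_gcd_eq_1\<close>)
  have pos: "M > 0" "N > 0"
    unfolding M_def N_def using m n by (auto intro!: Lcm_image_pos)
  define p where "p = (\<lambda>i\<in>{1..r}. m i * n i)"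
  have p: "p i = m i * n i" if "i \<in> {1..r}" for i
    using that by (simp add: p_def)
  have lcm_p: "M * N = (LCM i\<in>{1..r}. p i)"
    using Lcm_image_mult_coprime[of m "{1..r}" n] cop
    by (simp add: p M_def N_def cong: image_cong_simp)
  have "lcm_mean r f p = 1 / of_nat (M * N) *
      (\<Sum>d | d dvd M * N. (\<Prod>i\<in>{1..r}. f d (p i)) * of_nat (totient (M * N div d)))"
    by (rule lcm_mean_eq_sum_totient[OF f _ lcm_p]) (use m n in \<open>auto simp: p\<close>)
  also have "(\<Sum>d | d dvd M * N. (\<Prod>i\<in>{1..r}. f d (p i)) * of_nat (totient (M * N div d))) =
      (\<Sum>d | d dvd M. \<Sum>e | e dvd N.
        (\<Prod>i\<in>{1..r}. f (d * e) (p i)) * of_nat (totient (M * N div (d * e))))"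
    by (rule sum_divisors_mult_coprime[OF cop])
  also have "\<dots> = (\<Sum>d | d dvd M. \<Sum>e | e dvd N. A d * B e)"
  proof (intro sum.cong refl)
    fix d e assume "d \<in> {d. d dvd M}" "e \<in> {e. e dvd N}"
    then obtain d' e' where *: "M = d * d'" "N = e * e'"
      by (auto elim!: dvdE)
    with pos have de_pos: "d > 0" "e > 0" "d' > 0" "e' > 0"
      by auto
    have "coprime d' e'"
      using cop by (simp add: *)
    then have "totient (M * N div (d * e)) = totient (M div d) * totient (N div e)"
      using de_pos by (simp add: * totient_mult_coprime flip: div_mult_div_if_dvd)
    moreover have "f (d * e) (p i) = f d (m i) * f e (n i)" if i: "i \<in> {1..r}" for i
    proof -
      \<comment> \<open>The product \<open>m i * d\<close> may fail to divide \<open>M\<close>, but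
        each factor does; coprimality to \<open>n i * e\<close> is therefore checked factor by
        factor.\<close>
      have "m i dvd M" "n i dvd N"
        using i by (auto simp: M_def N_def)
      moreover have "d dvd M" "e dvd N"
        by (simp_all add: *)
      ultimately have "coprime (m i * d) (n i * e)"
        using coprime_divisors[OF _ _ cop] by simp
      then show ?thesis
        using m[OF i] n[OF i] de_pos gcd_convolution_mult[OF f g h, of "m i" "n i" d e]
        by (simp add: p[OF i])
    qed
    ultimately show "(\<Prod>i\<in>{1..r}. f (d * e) (p i)) * of_nat (totient (M * N div (d * e))) = A d * B e"
      by (simp add: A_def B_def prod.distrib)
  qed
  also have "\<dots> = (\<Sum>d | d dvd M. A d) * (\<Sum>e | e dvd N. B e)"
    by (simp add: sum_product)
  also have "1 / of_nat (M * N) * \<dots> =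
      (1 / of_nat M * (\<Sum>d | d dvd M. A d)) * (1 / of_nat N * (\<Sum>e | e dvd N. B e))"
    by simp
  also have "\<dots> = lcm_mean r f m * lcm_mean r f n"
    using lcm_mean_eq_sum_totient[OF f m M_def] lcm_mean_eq_sum_totient[OF f n N_def]
    by (simp add: A_def B_def)
  finally show "lcm_mean r f (\<lambda>i\<in>{1..r}. m i * n i) = lcm_mean r f m * lcm_mean r f n"
    unfolding p_def .
qed

theorem proposition19:
  fixes g h :: "nat \<Rightarrow> complex" and f :: "nat \<Rightarrow> nat \<Rightarrow> complex" and r :: nat
  assumes "r \<ge> 1"
    and "\<And>k n. k > 0 \<Longrightarrow> n > 0 \<Longrightarrow> f k n = (\<Sum>d | d dvd gcd k n. g d * h (n div d))"
  shows
    "(\<forall>m\<in>pos_tuples r. \<forall>M. M = (LCM i\<in>{1..r}. m i) \<longrightarrow>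
        lcm_mean r f m =
          (\<Sum>d\<in>(\<Pi>\<^sub>E i\<in>{1..r}. {e. e dvd m i}).
             (\<Prod>i\<in>{1..r}. g (d i)) / of_nat (LCM i\<in>{1..r}. d i)
               * (\<Prod>i\<in>{1..r}. h (m i div d i))) \<and>
        lcm_mean r f m =
          1 / of_nat M *
            (\<Sum>d | d dvd M. (\<Prod>i\<in>{1..r}. f d (m i)) * of_nat (totient (M div d)))) \<and>
     (multiplicative g \<and> multiplicative h \<longrightarrow> multiplicative_multi r (lcm_mean r f))"
proof (intro conjI ballI allI impI)
  fix m M assume "m \<in> pos_tuples r" and M: "M = (LCM i\<in>{1..r}. m i)"
  then have m: "m i > 0" if "i \<in> {1..r}" for i
    using that by (auto simp: pos_tuples_def PiE_iff)
  show "lcm_mean r f m =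
      (\<Sum>d\<in>(\<Pi>\<^sub>E i\<in>{1..r}. {e. e dvd m i}).
         (\<Prod>i\<in>{1..r}. g (d i)) / of_nat (LCM i\<in>{1..r}. d i)
           * (\<Prod>i\<in>{1..r}. h (m i div d i)))"
    by (rule lcm_mean_eq_sum_tuples[OF assms(2) m])
  show "lcm_mean r f m = 1 / of_nat M *
      (\<Sum>d | d dvd M. (\<Prod>i\<in>{1..r}. f d (m i)) * of_nat (totient (M div d)))"
    by (rule lcm_mean_eq_sum_totient[OF assms(2) m M])
next
  assume "multiplicative g \<and> multiplicative h"
  then have g: "multiplicative g" and h: "multiplicative h"
    by auto
  show "multiplicative_multi r (lcm_mean r f)"
    by (rule multiplicative_multi_lcm_mean[OF assms(2) g h])
qed

end
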